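(* For every $p\in(2,\infty)$ there exist weights $w,\sigma$ on $\mathbb{R}$ with $[\sigma]_{A_\infty}<\infty$ and $[w,\sigma]_{A_p}<\infty$, and a function $f\in L^p(\sigma)$ with $\operatorname{supp}(f)\subseteq[0,1]$, such that $S(f\sigma)\notin L^p(w)$, where $S$ is the dyadic square function over $\mathbb{R}$; moreover $S$ can be taken to be just the dyadic square function over $[0,1)$, i.e. already $S_{[0,1)}(f\sigma|_{[0,1)})\notin L^p([0,1),w(x)\,dx)$.
   Context: Intervals are half-open: $[a,b)$ with $a<b$ real. A dyadic interval is one of the form $[k2^{-n},(k+1)2^{-n})$ with $n,k\in\mathbb{Z}$; its dyadic children are its two dyadic halves. $|\cdot|$ and $dx$ denote Lebesgue measure, $\langle f\rangle_I=\frac1{|I|}\int_I f\,dx$, and $\sigma(I)=\int_I\sigma\,dx$. Let $Q_0$ be $\mathbb{R}$ or a dyadic interval such as $[0,1)$, and let $\mathcal{D}$ be the family of dyadic intervals contained in $Q_0$. For $f\in L^1_{\mathrm{loc}}(Q_0)$ (integrable over every interval contained in $Q_0$) and $Q\in\mathcal{D}$ put $$\Delta_Q f=\sum_{R\in\mathrm{ch}(Q)}\langle f\rangle_R 1_R-\langle f\rangle_Q1_Q ,$$ where $\mathrm{ch}(Q)$ is the set of dyadic children of $Q$. The dyadic square function over $Q_0$ is $S_{Q_0}f(x)=\big(\sum_{Q\in\mathcal{D}}(\Delta_Qf(x))^2\big)^{1/2}$, $x\in Q_0$ (written $S$ when $Q_0$ is understood). A weight on $Q_0$ is a measurable function that is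 positive a.e. on $Q_0$ and integrable over every interval contained in $Q_0$. $L^p(\sigma)=L^p(Q_0,\sigma(x)\,dx)$. For weights $w,\sigma$ on $\mathbb{R}$: $$[\sigma]_{A_\infty}=\sup_{Q}\frac1{\sigma(Q)}\int_Q M_Q\sigma(x)\,dx,\qquad M_Q\sigma(x)=\sup\{\langle\sigma\rangle_R: R\subseteq Q \text{ an interval},\ x\in R\},$$ $$[w,\sigma]_{A_p}=\sup_Q\langle w\rangle_Q\langle\sigma\rangle_Q^{p-1},$$ the suprema over $Q$ being over all (not only dyadic) intervals $Q\subseteq\mathbb{R}$. *)

theory Defs
  imports "HOL-Analysis.Analysis"
begin

section \<open>Intervals and averages\<close>

definition intervals :: "real set set" where
  "intervals = {{a..<b} | a b. a < b}"

definition dyadic_intervals :: "real set set" where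
  "dyadic_intervals =
     {{of_int k * 2 powi (- n) ..< (of_int k + 1) * 2 powi (- n)} | (n :: int) (k :: int). True}"

definition dyadic_children :: "real set \<Rightarrow> real set set" where
  "dyadic_children Q =
     {{Inf Q ..< (Inf Q + Sup Q) / 2}, {(Inf Q + Sup Q) / 2 ..< Sup Q}}"

definition average :: "(real \<Rightarrow> real) \<Rightarrow> real set \<Rightarrow> real" where
  "average f I = (LINT x:I|lebesgue. f x) / measure lebesgue I"

section \<open>The dyadic square function\<close>

definition dyadic_diff :: "real set \<Rightarrow> (real \<Rightarrow> real) \<Rightarrow> real \<Rightarrow> real" where
  "dyadic_diff Q f x =
     (\<Sum>R\<in>dyadic_children Q. average f R * indicator R x) - average f Q * indicator Q x"

text \<open>Powers with a positive exponent on \<open>[0, \<infinity>]\<close>, with \<open>\<infinity>\<close> raised to \<open>p\<close> equal to \<open>\<infinity>\<close>.\<close>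

definition ennpowr :: "ennreal \<Rightarrow> real \<Rightarrow> ennreal" where
  "ennpowr t p = (if t = \<infinity> then \<infinity> else ennreal (enn2real t powr p))"

text \<open>
  The square function takes values in \<open>[0, \<infinity>]\<close>. Only the values of \<open>f\<close> on \<open>Q0\<close> enter, so
  that no explicit restriction of \<open>f\<close> to \<open>Q0\<close> is needed.
\<close>

definition square_function :: "real set \<Rightarrow> (real \<Rightarrow> real) \<Rightarrow> real \<Rightarrow> ennreal" where
  "square_function Q0 f x =
     ennpowr (\<Sum>\<^sub>\<infinity>Q\<in>{Q \<in> dyadic_intervals. Q \<subseteq> Q0}. ennreal ((dyadic_diff Q f x)\<^sup>2)) (1 / 2)"

section \<open>Weights and weighted Lebesgue spaces\<close>

definition weight_on :: "real set \<Rightarrow> (real \<Rightarrow> real) \<Rightarrow> bool" where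
  "weight_on Q0 w \<longleftrightarrow>
     w \<in> borel_measurable (lebesgue_on Q0) \<and>
     (AE x in lebesgue_on Q0. 0 < w x) \<and>
     (\<forall>I\<in>intervals. I \<subseteq> Q0 \<longrightarrow> set_integrable lebesgue I w)"

definition weighted_measure :: "real set \<Rightarrow> (real \<Rightarrow> real) \<Rightarrow> real measure" where
  "weighted_measure Q0 w = density (lebesgue_on Q0) (\<lambda>x. ennreal (w x))"

definition Lp :: "real \<Rightarrow> 'a measure \<Rightarrow> ('a \<Rightarrow> real) set" where
  "Lp p M = {f \<in> borel_measurable M. (\<integral>\<^sup>+ x. ennreal (\<bar>f x\<bar> powr p) \<partial>M) < \<infinity>}"

text \<open>The same condition for functions with values in \<open>[0, \<infinity>]\<close>, such as the square function.\<close>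

definition Lp_enn :: "real \<Rightarrow> 'a measure \<Rightarrow> ('a \<Rightarrow> ennreal) set" where
  "Lp_enn p M = {g \<in> borel_measurable M. (\<integral>\<^sup>+ x. ennpowr (g x) p \<partial>M) < \<infinity>}"

section \<open>Weight characteristics\<close>

definition local_maximal :: "real set \<Rightarrow> (real \<Rightarrow> real) \<Rightarrow> real \<Rightarrow> ennreal" where
  "local_maximal Q \<sigma> x = (SUP R\<in>{R \<in> intervals. R \<subseteq> Q \<and> x \<in> R}. ennreal (average \<sigma> R))"

definition Ainf_char :: "(real \<Rightarrow> real) \<Rightarrow> ennreal" where
  "Ainf_char \<sigma> =
     (SUP Q\<in>intervals.
        (\<integral>\<^sup>+ x\<in>Q. local_maximal Q \<sigma> x \<partial>lebesgue) / ennreal (LINT x:Q|lebesgue. \<sigma> x))"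

definition Ap_char :: "real \<Rightarrow> (real \<Rightarrow> real) \<Rightarrow> (real \<Rightarrow> real) \<Rightarrow> ennreal" where
  "Ap_char p w \<sigma> = (SUP Q\<in>intervals. ennreal (average w Q * average \<sigma> Q powr (p - 1)))"

end

(* With t = 1 - ln x, take sigma(x) = |x|^(1/(p-1)), w(x) = 1/(x t^(1+e)) near 0+ with e = (p-2)/4,
   and f sigma = t^(-b) on every other dyadic annulus at 0, with b = (1+e)/p. The weight w is
   integrable and at most 1/|x|, which gives the A_p condition, and |f|^p sigma is at most w.
   Since f sigma vanishes on the right half of every other interval [0, 2^-k), each of these
   contributes about t^(-2b) to the square function, which is therefore at least of order
   t^(1/2-b) at x. As (1/2-b)p = e, its p-th power times w is at least of order 1/(x t), which
   is not integrable at 0. *)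
theory Submission
  imports Defs "HOL-Probability.Sinc_Integral" "HOL-Real_Asymp.Real_Asymp"
begin

section \<open>Logarithmic integrals at the origin\<close>

text \<open>An antiderivative is \<open>(1 - ln x) powr - e / e\<close>, which tends to 0 at the
  origin because \<open>e\<close> is positive. This is what makes the weight integrable near
  0.\<close>

lemma set_integrable_log_kernel:
  fixes e :: real
  assumes "0 < e"
  shows "set_integrable lebesgue {0<..<1} (\<lambda>x. (1 - ln x) powr - (1 + e) / x)"
proof -
  \<comment> \<open>The value at 0 is set to the limit by hand, since the formula there would use
    the default value of \<open>ln\<close>. With it \<open>F\<close> is continuous on the closed
    interval.\<close>
  define F where "F = (\<lambda>x::real. if x \<le> 0 then 0 else (1 - ln x) powr - e / e)"
  have "((\<lambda>x. (1 - ln x) powr - (1 + e) / x) has_integral (F 1 - F 0)) {0..1}"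
  proof (rule fundamental_theorem_of_calculus_interior)
    show "continuous_on {0..1} F"
    proof (rule continuous_on_eq_continuous_within[THEN iffD2, rule_format])
      fix x :: real assume x: "x \<in> {0..1}"
      show "continuous (at x within {0..1}) F"
      proof (cases "x = 0")
        case True
        have "((\<lambda>x::real. (1 - ln x) powr - e / e) \<longlongrightarrow> 0) (at_right 0)"
          using assms by real_asymp
        moreover have "\<forall>\<^sub>F x in at_right 0. (1 - ln x) powr - e / e = F x"
          by (auto simp: F_def eventually_at_filter)
        ultimately have "(F \<longlongrightarrow> F 0) (at_right 0)"
          using Lim_transform_eventually by (force simp: F_def)
        then have "(F \<longlongrightarrow> F 0) (at 0 within {0..1})"
          by (auto simp: at_within_Icc_at_right)
        with True show ?thesis
          by (simp add: continuous_within)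
      next
        case False
        with x have "0 < x" "x \<le> 1" by auto
        then have "ln x \<le> 0" by simp
        then have "ln x \<noteq> 1" by linarith
        then have "isCont (\<lambda>x. (1 - ln x) powr - e / e) x"
          using assms \<open>0 < x\<close> by (intro continuous_intros) auto
        moreover have "\<forall>\<^sub>F y in nhds x. F y = (1 - ln y) powr - e / e"
          using eventually_nhds_in_open[of "{0<..}" x] \<open>0 < x\<close>
          by (auto simp: F_def elim: eventually_mono)
        ultimately have "isCont F x"
          using isCont_cong[of F "\<lambda>x. (1 - ln x) powr - e / e" x] by simp
        then show ?thesis
          by (rule continuous_at_imp_continuous_at_within)
      qed
    qed
    fix x :: real assume x: "x \<in> {0<..<1}"
    then have l: "ln x < 1" "ln x \<noteq> 1" by (smt (verit) greaterThanLessThan_iff ln_less_zero)+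
    have "((\<lambda>x. (1 - ln x) powr - e / e) has_real_derivative (1 - ln x) powr - (1 + e) / x) (at x)"
      using x l assms by (auto intro!: derivative_eq_intros simp: field_simps powr_diff powr_add powr_minus)
    then have "(F has_real_derivative (1 - ln x) powr - (1 + e) / x) (at x)"
      by (rule has_field_derivative_transform_within_open[of _ _ _ "{0<..}"]) (use x in \<open>auto simp: F_def\<close>)
    then show "(F has_vector_derivative (1 - ln x) powr - (1 + e) / x) (at x)"
      by (simp add: has_real_derivative_iff_has_vector_derivative)
  qed simp
  \<comment> \<open>A nonnegative gauge-integrable function is Lebesgue integrable.\<close>
  then have "(\<lambda>x. (1 - ln x) powr - (1 + e) / x) absolutely_integrable_on {0..1}"
    by (intro nonnegative_absolutely_integrable_1) (auto simp: integrable_on_def)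
  then show ?thesis
    by (rule set_integrable_subset) auto
qed

text \<open>This is the borderline case of the kernel: the antiderivative
  \<open>- ln (1 - ln x)\<close> is unbounded at 0, so the integrals over \<open>{s..d/2}\<close>
  exceed every bound as \<open>s\<close> decreases to 0.\<close>

lemma nn_integral_log_kernel_infinite:
  fixes d :: real
  assumes "0 < d" "d \<le> 1"
  shows "(\<integral>\<^sup>+x\<in>{0<..<d}. ennreal (1 / (x * (1 - ln x))) \<partial>lborel) = \<infinity>"
proof -
  let ?h = "\<lambda>x::real. 1 / (x * (1 - ln x))"
  let ?I = "\<integral>\<^sup>+x\<in>{0<..<d}. ennreal (?h x) \<partial>lborel"
  \<comment> \<open>Stopping at \<open>d/2\<close> keeps the closed interval inside
    \<open>{0<..<d}\<close> and strictly below 1.\<close>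
  have *: "ennreal (ln (1 - ln s) - ln (1 - ln (d/2))) \<le> ?I" if s: "0 < s" "s < d / 2" for s
  proof -
    have "ennreal (ln (1 - ln s) - ln (1 - ln (d/2))) = ennreal (- ln (1 - ln (d/2)) - (- ln (1 - ln s)))" by simp
    also have "\<dots> = (\<integral>\<^sup>+x. ennreal (?h x) * indicator {s..d/2} x \<partial>lborel)"
    proof (rule sym, rule nn_integral_FTC_Icc)
      fix x assume x: "x \<in> {s..d/2}"
      then have "0 < x" "x < 1" using s assms by auto
      then have l: "ln x < 0" by simp
      have l1: "ln x < 1" using l by simp
      show "((\<lambda>x. - ln (1 - ln x)) has_real_derivative ?h x) (at x)"
        using \<open>0 < x\<close> l l1 by (auto intro!: derivative_eq_intros simp: field_simps)
      show "0 \<le> ?h x"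
        using \<open>0 < x\<close> l1 by simp
    qed (use s in auto)
    also have "\<dots> \<le> ?I"
      by (intro nn_integral_mono mult_left_mono) (use s in \<open>auto simp: indicator_def\<close>)
    finally show ?thesis .
  qed
  have "filterlim (\<lambda>s::real. ln (1 - ln s) - ln (1 - ln (d/2))) at_top (at_right 0)"
    using assms by real_asymp
  then have "\<forall>\<^sub>F s in at_right 0. B \<le> ln (1 - ln s) - ln (1 - ln (d/2))" for B
    by (simp add: filterlim_at_top)
  moreover have "\<forall>\<^sub>F s in at_right (0::real). 0 < s \<and> s < d / 2"
    using assms by (auto simp: eventually_at_right intro!: exI[of _ "d / 2"])
  ultimately have "\<forall>\<^sub>F s in at_right 0. B \<le> ln (1 - ln s) - ln (1 - ln (d/2)) \<and> 0 < s \<and> s < d / 2" for B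
    by (rule eventually_conj)
  then have "\<exists>s. B \<le> ln (1 - ln s) - ln (1 - ln (d/2)) \<and> 0 < s \<and> s < d / 2" for B
    by (rule eventually_happens'[rotated]) simp
  then have le: "ennreal B \<le> ?I" for B
    using * by (meson ennreal_leI order_trans)
  show ?thesis
  proof (rule ccontr)
    assume "?I \<noteq> \<infinity>"
    then obtain n where "?I < of_nat n"
      using ennreal_Ex_less_of_nat[of ?I] by (auto simp: less_top)
    with le[of "real n"] show False
      by (simp add: ennreal_of_nat_eq_real_of_nat)
  qed
qed

section \<open>Integrals and averages over half-open intervals\<close>

lemma average_Ico:
  assumes "a < b"
  shows "average f {a..<b} = (LINT x:{a..<b}|lebesgue. f x) / (b - a)"
  using assms by (simp add: average_def)

lemma set_integrable_const_Ico: "set_integrable lebesgue {a..<b::real} (\<lambda>x. c::real)"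
  by (rule set_integrable_subset[of _ "{a..b}"])
     (auto intro!: absolutely_integrable_continuous_real continuous_intros)

lemma set_lint_const_Ico:
  assumes "a \<le> b"
  shows "(LINT x:{a..<b::real}|lebesgue. c::real) = c * (b - a)"
  using assms by (simp add: set_lebesgue_integral_def mult.commute)

lemma set_lint_Ico_le:
  fixes f :: "real \<Rightarrow> real"
  assumes "a \<le> b" "set_integrable lebesgue {a..<b} f" "\<And>x. a \<le> x \<Longrightarrow> x < b \<Longrightarrow> f x \<le> B"
  shows "(LINT x:{a..<b}|lebesgue. f x) \<le> B * (b - a)"
proof -
  have "(LINT x:{a..<b}|lebesgue. f x) \<le> (LINT x:{a..<b}|lebesgue. B)"
    by (rule set_integral_mono) (use assms set_integrable_const_Ico in auto)
  with assms show ?thesis by (simp add: set_lint_const_Ico)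
qed

lemma set_lint_mono_set:
  fixes f :: "'a \<Rightarrow> real"
  assumes "A \<subseteq> B" "A \<in> sets M" "set_integrable M B f" "\<And>x. x \<in> B \<Longrightarrow> 0 \<le> f x"
  shows "(LINT x:A|M. f x) \<le> (LINT x:B|M. f x)"
  unfolding set_lebesgue_integral_def
proof (rule integral_mono)
  show "integrable M (\<lambda>x. indicator A x *\<^sub>R f x)"
    using set_integrable_subset[OF assms(3,2,1)] by (simp add: set_integrable_def)
  show "integrable M (\<lambda>x. indicator B x *\<^sub>R f x)"
    using assms(3) by (simp add: set_integrable_def)
qed (use assms in \<open>auto simp: indicator_def\<close>)

lemma set_lint_Ico_ge:
  fixes f :: "real \<Rightarrow> real"
  assumes "a \<le> c" "c \<le> d" "d \<le> b" "set_integrable lebesgue {a..<b} f"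
    and nn: "\<And>x. a \<le> x \<Longrightarrow> x < b \<Longrightarrow> 0 \<le> f x"
    and ge: "\<And>x. c \<le> x \<Longrightarrow> x < d \<Longrightarrow> B \<le> f x"
  shows "B * (d - c) \<le> (LINT x:{a..<b}|lebesgue. f x)"
proof -
  have "B * (d - c) = (LINT x:{c..<d}|lebesgue. B)"
    using assms by (simp add: set_lint_const_Ico)
  also have "\<dots> \<le> (LINT x:{c..<d}|lebesgue. f x)"
    by (rule set_integral_mono)
       (use assms set_integrable_const_Ico in \<open>auto intro: set_integrable_subset\<close>)
  also have "\<dots> \<le> (LINT x:{a..<b}|lebesgue. f x)"
    by (rule set_lint_mono_set) (use assms in auto)
  finally show ?thesis .
qed

lemma average_le:
  fixes f :: "real \<Rightarrow> real"
  assumes "a < b" "set_integrable lebesgue {a..<b} f" "\<And>x. a \<le> x \<Longrightarrow> x < b \<Longrightarrow> f x \<le> B"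
  shows "average f {a..<b} \<le> B"
  using set_lint_Ico_le[of a b f B] assms by (simp add: average_Ico pos_divide_le_eq)

section \<open>Power weights and the two characteristics\<close>

lemma set_integrable_powr_abs:
  fixes g :: real
  assumes "0 < g"
  shows "set_integrable lebesgue {a..<b} (\<lambda>x. \<bar>x\<bar> powr g)"
proof (rule set_integrable_subset)
  have "continuous_on {a..b} (\<lambda>x. \<bar>x\<bar> powr g)"
    by (rule continuous_on_powr') (auto intro!: continuous_intros simp: assms)
  then show "set_integrable lebesgue {a..b} (\<lambda>x. \<bar>x\<bar> powr g)"
    by (rule absolutely_integrable_continuous_real)
qed auto

lemma average_powr_abs_le:
  fixes g :: real
  assumes "0 < g" "a < b"
  shows "average (\<lambda>x. \<bar>x\<bar> powr g) {a..<b} \<le> max \<bar>a\<bar> \<bar>b\<bar> powr g"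
  using assms by (intro average_le set_integrable_powr_abs) (auto intro!: powr_mono2)

lemma average_nonneg: "(\<And>x. 0 \<le> f x) \<Longrightarrow> 0 \<le> average f I"
  by (auto simp: average_def set_lebesgue_integral_def)

text \<open>Let \<open>M\<close> be the larger modulus of an endpoint. The interval has length at
  most \<open>2 * M\<close> if it contains 0 and at most \<open>M\<close> otherwise, so on the
  quarter next to that endpoint the modulus is at least \<open>M / 2\<close>.\<close>

lemma set_lint_powr_abs_ge:
  fixes g :: real
  assumes "0 < g" "a < b"
  shows "(max \<bar>a\<bar> \<bar>b\<bar> / 2) powr g * ((b - a) / 4) \<le> (LINT x:{a..<b}|lebesgue. \<bar>x\<bar> powr g)"
proof (cases "\<bar>a\<bar> \<le> \<bar>b\<bar>")
  case True
  then have "(max \<bar>a\<bar> \<bar>b\<bar> / 2) powr g * (b - (b - (b - a) / 4)) \<le> (LINT x:{a..<b}|lebesgue. \<bar>x\<bar> powr g)"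
    using assms by (intro set_lint_Ico_ge set_integrable_powr_abs) (auto intro!: powr_mono2 simp: field_simps)
  then show ?thesis by simp
next
  case False
  then have "(max \<bar>a\<bar> \<bar>b\<bar> / 2) powr g * ((a + (b - a) / 4) - a) \<le> (LINT x:{a..<b}|lebesgue. \<bar>x\<bar> powr g)"
    using assms by (intro set_lint_Ico_ge set_integrable_powr_abs) (auto intro!: powr_mono2 simp: field_simps)
  then show ?thesis by simp
qed

text \<open>With \<open>M\<close> the larger modulus of an endpoint of \<open>Q\<close>, the local
  maximal function is at most \<open>M powr g\<close> everywhere, while the average of the weight
  over \<open>Q\<close> is at least a fixed multiple of \<open>M powr g\<close>.\<close>

lemma Ainf_char_powr_abs_finite:
  fixes g :: real
  assumes "0 < g"
  shows "Ainf_char (\<lambda>x. \<bar>x\<bar> powr g) < \<infinity>"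
proof -
  have "Ainf_char (\<lambda>x. \<bar>x\<bar> powr g) \<le> ennreal (4 * 2 powr g)"
    unfolding Ainf_char_def
  proof (rule SUP_least)
    fix Q assume "Q \<in> intervals"
    then obtain a b where Q: "Q = {a..<b}" "a < b" by (auto simp: intervals_def)
    define M where "M = max \<bar>a\<bar> \<bar>b\<bar>"
    have "M > 0" using Q by (auto simp: M_def)
    define s where "s = (LINT x:Q|lebesgue. \<bar>x\<bar> powr g)"
    have s: "(M / 2) powr g * ((b - a) / 4) \<le> s"
      using set_lint_powr_abs_ge[OF assms \<open>a < b\<close>] by (simp add: M_def s_def Q)
    \<comment> \<open>Strict positivity of \<open>s\<close> turns the division in
      \<open>ennreal\<close> into a division of reals.\<close>
    have "0 < (M / 2) powr g * ((b - a) / 4)" using \<open>M > 0\<close> Q by auto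
    with s have "0 < s" by linarith
    have max: "local_maximal Q (\<lambda>x. \<bar>x\<bar> powr g) x \<le> ennreal (M powr g)" for x
      unfolding local_maximal_def
    proof (rule SUP_least)
      fix R assume "R \<in> {R \<in> intervals. R \<subseteq> Q \<and> x \<in> R}"
      then obtain c d where R: "R = {c..<d}" "c < d" "{c..<d} \<subseteq> {a..<b}"
        by (auto simp: intervals_def Q)
      then have "a \<le> c" "d \<le> b" by auto
      have "average (\<lambda>x. \<bar>x\<bar> powr g) R \<le> max \<bar>c\<bar> \<bar>d\<bar> powr g"
        using average_powr_abs_le[OF assms \<open>c < d\<close>] R by simp
      also have "\<dots> \<le> M powr g"
        using assms \<open>a \<le> c\<close> \<open>d \<le> b\<close> \<open>c < d\<close> by (intro powr_mono2) (auto simp: M_def)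
      finally show "ennreal (average (\<lambda>x. \<bar>x\<bar> powr g) R) \<le> ennreal (M powr g)"
        by (rule ennreal_leI)
    qed
    have "(\<integral>\<^sup>+ x\<in>Q. local_maximal Q (\<lambda>x. \<bar>x\<bar> powr g) x \<partial>lebesgue)
        \<le> (\<integral>\<^sup>+ x\<in>Q. ennreal (M powr g) \<partial>lebesgue)"
      by (intro nn_integral_mono mult_right_mono max) auto
    also have "\<dots> = ennreal (M powr g * (b - a))"
      using Q by (simp add: nn_integral_cmult_indicator ennreal_mult)
    finally have "(\<integral>\<^sup>+ x\<in>Q. local_maximal Q (\<lambda>x. \<bar>x\<bar> powr g) x \<partial>lebesgue) / ennreal s
        \<le> ennreal (M powr g * (b - a)) / ennreal s"
      by (rule divide_right_mono_ennreal)
    also have "\<dots> = ennreal (M powr g * (b - a) / s)"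
      using \<open>0 < s\<close> Q by (intro divide_ennreal) auto
    also have "\<dots> \<le> ennreal (4 * 2 powr g)"
    proof (rule ennreal_leI)
      have "M powr g * (b - a) = (4 * 2 powr g) * ((M / 2) powr g * ((b - a) / 4))"
        using \<open>M > 0\<close> by (simp add: powr_divide)
      also have "\<dots> \<le> (4 * 2 powr g) * s"
        by (intro mult_left_mono s) auto
      finally show "M powr g * (b - a) / s \<le> 4 * 2 powr g"
        using \<open>0 < s\<close> by (simp add: pos_divide_le_eq)
    qed
    finally show "(\<integral>\<^sup>+ x\<in>Q. local_maximal Q (\<lambda>x. \<bar>x\<bar> powr g) x \<partial>lebesgue) /
        ennreal (LINT x:Q|lebesgue. \<bar>x\<bar> powr g) \<le> ennreal (4 * 2 powr g)"
      unfolding s_def .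
  qed
  also have "\<dots> < \<infinity>" by simp
  finally show ?thesis .
qed

text \<open>The exponent \<open>1 / (p - 1)\<close> is undone by the power \<open>p - 1\<close>, so
  the factor from the power weight is at most the larger modulus \<open>M\<close> of an endpoint. It
  remains to bound \<open>M\<close> times the average of \<open>w\<close>.\<close>

lemma Ap_char_powr_abs_finite:
  fixes p :: real
  assumes p: "1 < p" and w: "integrable lebesgue w" and nn: "\<And>x. 0 \<le> w x"
    and le: "\<And>x. x \<noteq> 0 \<Longrightarrow> w x \<le> 1 / \<bar>x\<bar>"
  shows "Ap_char p w (\<lambda>x. \<bar>x\<bar> powr (1 / (p - 1))) < \<infinity>"
proof -
  define W where "W = (LINT x|lebesgue. w x)"
  have "W \<ge> 0" unfolding W_def using nn by simp
  have sw: "set_integrable lebesgue {a..<b} w" for a b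
    using w unfolding set_integrable_def by (rule integrable_mult_indicator[rotated]) auto
  have "Ap_char p w (\<lambda>x. \<bar>x\<bar> powr (1 / (p - 1))) \<le> ennreal (2 * W + 2)"
    unfolding Ap_char_def
  proof (intro SUP_least ennreal_leI)
    fix Q assume "Q \<in> intervals"
    then obtain a b where Q: "Q = {a..<b}" "a < b" by (auto simp: intervals_def)
    define M where "M = max \<bar>a\<bar> \<bar>b\<bar>"
    have "M > 0" using Q by (auto simp: M_def)
    have "average (\<lambda>x. \<bar>x\<bar> powr (1 / (p - 1))) Q powr (p - 1) \<le> (M powr (1 / (p - 1))) powr (p - 1)"
      using average_powr_abs_le[of "1 / (p - 1)" a b] p Q
      by (intro powr_mono2 average_nonneg) (auto simp: M_def)
    also have "\<dots> = M" using p \<open>M > 0\<close> by (simp add: powr_powr)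
    finally have 1: "average (\<lambda>x. \<bar>x\<bar> powr (1 / (p - 1))) Q powr (p - 1) \<le> M" .
    \<comment> \<open>If \<open>Q\<close> is long compared with \<open>M\<close>, the total mass
      \<open>W\<close> controls the average. Otherwise all points of \<open>Q\<close> have modulus
      at least \<open>M - (b - a)\<close>, hence at least \<open>M / 2\<close>, and the pointwise
      bound gives \<open>w x \<le> 2 / M\<close>.\<close>
    have 2: "average w Q * M \<le> 2 * W + 2"
    proof (cases "M \<le> 2 * (b - a)")
      case True
      have "(LINT x:{a..<b}|lebesgue. w x) \<le> W"
        using set_lint_mono_set[of "{a..<b}" UNIV lebesgue w] nn w
        by (simp add: W_def set_lebesgue_integral_def set_integrable_def)
      then have "average w Q * M \<le> W / (b - a) * M"
        using Q \<open>M > 0\<close> by (intro mult_right_mono) (auto simp: average_Ico divide_right_mono)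
      also have "\<dots> \<le> W / (b - a) * (2 * (b - a))"
        using Q \<open>W \<ge> 0\<close> True by (intro mult_left_mono) auto
      also have "\<dots> = 2 * W"
      proof -
        have "W / l * (2 * l) = 2 * W" if "l \<noteq> 0" for l using that by simp
        then show ?thesis using Q by (metis eq_iff_diff_eq_0 less_irrefl)
      qed
      finally show ?thesis by simp
    next
      case False
      have "average w {a..<b} \<le> 2 / M"
      proof (rule average_le)
        fix x assume x: "a \<le> x" "x < b"
        then have "M / 2 \<le> \<bar>x\<bar>" using False by (auto simp: M_def max_def split: if_splits)
        then have "1 / \<bar>x\<bar> \<le> 1 / (M / 2)"
          using \<open>M > 0\<close> by (intro divide_left_mono mult_pos_pos) auto
        moreover have "x \<noteq> 0" using \<open>M / 2 \<le> \<bar>x\<bar>\<close> \<open>M > 0\<close> by auto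
        ultimately show "w x \<le> 2 / M" using le[of x] by simp
      qed (use Q sw in auto)
      then show ?thesis using Q \<open>W \<ge> 0\<close> \<open>M > 0\<close> by (simp add: pos_le_divide_eq)
    qed
    have "average w Q * average (\<lambda>x. \<bar>x\<bar> powr (1 / (p - 1))) Q powr (p - 1) \<le> average w Q * M"
      by (intro mult_left_mono 1 average_nonneg nn)
    with 2 show "average w Q * average (\<lambda>x. \<bar>x\<bar> powr (1 / (p - 1))) Q powr (p - 1) \<le> 2 * W + 2"
      by linarith
  qed
  also have "\<dots> < \<infinity>" by simp
  finally show ?thesis .
qed

section \<open>Lower bounds for the dyadic square function\<close>

text \<open>Every family in \<open>ennreal\<close> is summable, so a finite subfamily bounds the
  full sum from below; the value infinity is treated apart, as in \<open>ennpowr\<close>.\<close>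

lemma square_function_ge:
  assumes "finite F" "F \<subseteq> {Q \<in> dyadic_intervals. Q \<subseteq> Q0}"
    and "0 \<le> c" "c\<^sup>2 \<le> (\<Sum>Q\<in>F. (dyadic_diff Q f x)\<^sup>2)"
  shows "ennreal c \<le> square_function Q0 f x"
proof -
  let ?h = "\<lambda>Q. ennreal ((dyadic_diff Q f x)\<^sup>2)"
  let ?s = "\<Sum>\<^sub>\<infinity>Q\<in>{Q \<in> dyadic_intervals. Q \<subseteq> Q0}. ?h Q"
  have "ennreal (c\<^sup>2) \<le> (\<Sum>Q\<in>F. ?h Q)"
    using assms by (simp add: sum_ennreal ennreal_leI)
  also have "\<dots> = infsum ?h F"
    using assms by simp
  also have "\<dots> \<le> ?s"
    using assms by (intro infsum_mono_neutral nonneg_summable_on_complete) auto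
  finally have le: "ennreal (c\<^sup>2) \<le> ?s" .
  show ?thesis
  proof (cases "?s = \<infinity>")
    case True
    then show ?thesis by (simp add: square_function_def ennpowr_def)
  next
    case False
    then have "c\<^sup>2 \<le> enn2real ?s"
      using enn2real_mono[OF le] by (simp add: less_top)
    then have "c \<le> enn2real ?s powr (1 / 2)"
      using assms(3) by (simp add: powr_half_sqrt real_le_rsqrt)
    with False show ?thesis
      by (simp add: square_function_def ennpowr_def ennreal_leI)
  qed
qed

text \<open>Since the right half carries no mass, passing from the left child to its parent halves
  the average, and the other half is the difference.\<close>

lemma dyadic_diff_left_half:
  assumes u: "0 < u" and x: "x \<in> {0..<u}" and z: "\<And>y. u \<le> y \<Longrightarrow> y < 2 * u \<Longrightarrow> g y = 0"
  shows "dyadic_diff {0..<2 * u} g x = average g {0..<u} / 2"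
proof -
  have c: "dyadic_children {0..<2 * u} = {{0..<u}, {u..<2 * u}}"
    using u by (simp add: dyadic_children_def)
  \<comment> \<open>The children form a set, so they must be told apart before the sum can be split
    into two terms.\<close>
  have "u \<in> {u..<2 * u}" "u \<notin> {0..<u}"
    using u by auto
  then have "{0..<u} \<noteq> {u..<2 * u}"
    by blast
  then have "(\<Sum>R\<in>{{0..<u}, {u..<2 * u}}. average g R * indicator R x) = average g {0..<u}"
    using u x by (subst sum.insert) auto
  then have d: "dyadic_diff {0..<2 * u} g x = average g {0..<u} - average g {0..<2 * u}"
    using u x by (simp add: dyadic_diff_def c)
  have "(LINT x:{0..<2 * u}|lebesgue. g x) = (LINT x:{0..<u}|lebesgue. g x)"
    unfolding set_lebesgue_integral_def
    by (rule Bochner_Integration.integral_cong) (use z u in \<open>auto simp: indicator_def\<close>)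
  with u have "average g {0..<2 * u} = average g {0..<u} / 2"
    by (simp add: average_Ico)
  with d show ?thesis by simp
qed

text \<open>The length is 2^-(2j+1): the interval has \<open>k = 0\<close> and the odd scale
  \<open>n = 2 * j + 1\<close>.\<close>

lemma dyadic_interval_zero: "{0..<2 * (1 / 4) ^ Suc j} \<in> dyadic_intervals"
proof -
  have "(2::real) powi (- int (2 * j + 1)) = inverse (2 ^ (2 * j + 1))"
    by (simp only: power_int_minus power_int_of_nat)
  also have "\<dots> = 2 * (1 / 4) ^ Suc j"
    by (simp add: power_mult power_divide inverse_eq_divide)
  finally have *: "(2::real) powi (- int (2 * j + 1)) = 2 * (1 / 4) ^ Suc j" .
  have "{0..<2 * (1 / 4) ^ Suc j} = {of_int 0 * (2::real) powi (- int (2 * j + 1))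
      ..<(of_int 0 + 1) * 2 powi (- int (2 * j + 1))}"
    by (simp only: * of_int_0 mult_zero_left add_0_left mult_1_left)
  then show ?thesis
    unfolding dyadic_intervals_def by blast
qed

section \<open>The function carried by alternate dyadic annuli\<close>

text \<open>With u = 4^-(j+1), the annulus [u/2, u) is kept and the next one, [u, 2u), is left out.
  The gap is the right half of the dyadic interval [0, 2u), and the kept annulus is the right half
  of its left child.\<close>

definition alternate_annuli :: "real set" where
  "alternate_annuli = (\<Union>j. {(1 / 4) ^ Suc j / 2..<(1 / 4) ^ Suc j})"

lemma alternate_annuli_subset: "alternate_annuli \<subseteq> {0<..<1}"
proof
  fix x assume "x \<in> alternate_annuli"
  then obtain j where j: "(1 / 4) ^ Suc j / 2 \<le> x" "x < (1 / 4) ^ Suc j"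
    by (auto simp: alternate_annuli_def)
  moreover have "(0::real) < (1 / 4) ^ Suc j" by simp
  moreover have "(1 / 4 :: real) ^ Suc j \<le> 1"
    by (rule power_le_one) auto
  ultimately show "x \<in> {0<..<1}" by auto
qed

lemma alternate_annuli_borel [measurable]: "alternate_annuli \<in> sets borel"
  by (simp add: alternate_annuli_def)

text \<open>An annulus with index \<open>i < j\<close> starts at or beyond the right end of the gap;
  any other one ends at or before its left end.\<close>

lemma alternate_annuli_gap:
  assumes "(1 / 4) ^ Suc j \<le> x" "x < 2 * (1 / 4) ^ Suc j"
  shows "x \<notin> alternate_annuli"
proof
  assume "x \<in> alternate_annuli"
  then obtain i where i: "(1 / 4) ^ Suc i / 2 \<le> x" "x < (1 / 4) ^ Suc i"
    by (auto simp: alternate_annuli_def)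
  show False
  proof (cases "i < j")
    case True
    then have "(1 / 4 :: real) ^ j \<le> (1 / 4) ^ Suc i"
      by (intro power_decreasing) auto
    with i(1) assms(2) show False by simp
  next
    case False
    then have "(1 / 4 :: real) ^ Suc i \<le> (1 / 4) ^ Suc j"
      by (intro power_decreasing) auto
    with i(2) assms(1) show False by linarith
  qed
qed

text \<open>This is the product of \<open>f\<close> and \<open>\<sigma>\<close> in the theorem, the
  only function whose square function is estimated.\<close>

definition log_block :: "real \<Rightarrow> real \<Rightarrow> real" where
  "log_block b x = indicator alternate_annuli x * (1 - ln x) powr - b"

lemma log_block_measurable [measurable]: "log_block b \<in> borel_measurable borel"
  unfolding log_block_def by measurable

lemma log_block_bounds:
  assumes "0 \<le> b"
  shows "0 \<le> log_block b x" "log_block b x \<le> indicator {0..<1} x"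
proof -
  show "log_block b x \<le> indicator {0..<1} x"
  proof (cases "x \<in> alternate_annuli")
    case True
    then have x: "0 < x" "x < 1" using alternate_annuli_subset by auto
    then have "ln x < 0" by simp
    then have "(1 - ln x) powr - b \<le> (1 - ln x) powr 0"
      using assms by (intro powr_mono) auto
    moreover have "ln x \<noteq> 1" using \<open>ln x < 0\<close> by linarith
    ultimately show ?thesis using x True by (simp add: log_block_def)
  qed (simp add: log_block_def)
qed (simp add: log_block_def)

lemma set_integrable_log_block:
  assumes "0 \<le> b"
  shows "set_integrable lebesgue {s..<t} (log_block b)"
proof (rule set_integrable_bound)
  show "set_integrable lebesgue {s..<t} (\<lambda>x. 1 :: real)"
    by (rule set_integrable_const_Ico)
  have "log_block b \<in> borel_measurable lebesgue"
    using measurable_completion[of "log_block b" lborel borel] log_block_measurable[of b] by simp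
  then show "set_borel_measurable lebesgue {s..<t} (log_block b)"
    unfolding set_borel_measurable_def
    by (intro borel_measurable_scaleR borel_measurable_indicator) auto
  show "AE x in lebesgue. x \<in> {s..<t} \<longrightarrow> norm (log_block b x) \<le> norm (1 :: real)"
  proof (intro AE_I2 impI)
    fix x
    show "norm (log_block b x) \<le> norm (1 :: real)"
      using log_block_bounds[OF assms, of x] by (simp add: indicator_def of_bool_def split: if_splits)
  qed
qed

text \<open>The intervals \<open>I j\<close> with \<open>j < J\<close> have \<open>x\<close> in
  their left half and vanishing data on their right half. Each contributes a difference of at least
  \<open>t powr - b / 8\<close>, and \<open>J\<close> is of order \<open>t\<close>.\<close>

lemma square_function_log_block_ge:
  assumes b: "0 \<le> b" "b \<le> 1" and Q0: "{0..<1} \<subseteq> Q0" and x: "0 < x" "x < exp (-4)"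
  shows "ennreal ((1 - ln x) powr (1 / 2 - b) / 32) \<le> square_function Q0 (log_block b) x"
proof -
  define t where "t = 1 - ln x"
  have "ln x < -4" using x by (metis ln_exp ln_less_cancel_iff exp_gt_zero)
  then have t: "5 < t" by (simp add: t_def)
  \<comment> \<open>For \<open>j < J\<close> this gives
    \<open>2 * (j + 1) \<le> t - 1 = - ln x\<close>, which will place \<open>x\<close> below
    4^-(j+1). The bound \<open>t / 5 \<le> J\<close> is where \<open>t > 5\<close>, that is
    \<open>x < exp (-4)\<close>, enters.\<close>
  define J where "J = nat \<lfloor>(t - 1) / 2\<rfloor>"
  have "real J = of_int \<lfloor>(t - 1) / 2\<rfloor>"
    unfolding J_def using t by simp
  then have "real J \<le> (t - 1) / 2" "(t - 1) / 2 - 1 < real J"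
    using of_int_floor_le[of "(t - 1) / 2"] real_of_int_floor_gt_diff_one[of "(t - 1) / 2"]
    by (simp_all only:)
  then have J: "real J \<le> (t - 1) / 2" "t / 5 \<le> real J"
    using t by (simp_all add: field_simps)
  define I where "I = (\<lambda>j::nat. {0..<2 * (1 / 4 :: real) ^ Suc j})"
  \<comment> \<open>Injectivity lets the sum over indices be read as a sum over a set of
    intervals.\<close>
  have inj: "inj I"
  proof (rule injI)
    fix i j assume "I i = I j"
    then have "Sup (I i) = Sup (I j)" by simp
    then have "(1 / 4 :: real) ^ Suc i = (1 / 4) ^ Suc j" by (simp add: I_def)
    then show "i = j" by (simp add: power_inject_exp')
  qed
  have I1: "I j \<subseteq> {0..<1}" for j
    using power_le_one[of "1/4::real" j] by (auto simp: I_def)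
  have diff: "t powr - b / 8 \<le> dyadic_diff (I j) (log_block b) x" if j: "j < J" for j
  proof -
    define u where "u = (1 / 4 :: real) ^ Suc j"
    have "0 < u" by (simp add: u_def)
    have ln4: "ln 4 = 2 * ln (2::real)"
      using ln_realpow[of "2::real" 2] by simp
    have ln2: "ln (2::real) < 1" using ln_2_less_1 .
    have lnu: "ln u = - (2 * (real j + 1) * ln 2)"
      by (simp add: u_def ln_realpow ln_div ln_mult ln4 algebra_simps)
    have jJ: "2 * (real j + 1) \<le> t - 1"
    proof -
      have "real j + 1 \<le> real J" using j by linarith
      then have "2 * (real j + 1) \<le> 2 * real J" by simp
      also have "\<dots> \<le> t - 1" using J(1) by simp
      finally show ?thesis .
    qed
    \<comment> \<open>Replacing \<open>ln 2\<close> by 1 is crude, but it loses only a constant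
      factor in the number of intervals.\<close>
    have "- ln u = 2 * (real j + 1) * ln 2" by (simp add: lnu)
    also have "\<dots> < 2 * (real j + 1) * 1"
      using ln2 by (intro mult_strict_left_mono) auto
    also have "\<dots> \<le> t - 1" using jJ by simp
    finally have lnu': "- ln u < t - 1" .
    then have "ln x < ln u" by (simp add: t_def)
    then have "x < u" using x \<open>0 < u\<close> by simp
    \<comment> \<open>Here \<open>1 - ln y\<close> is at most \<open>t + ln 2\<close>, hence at most
      \<open>2 * t\<close>, and \<open>b \<le> 1\<close> limits the loss from the factor 2 to one
      half.\<close>
    have ge: "t powr - b / 2 \<le> log_block b y" if y: "u / 2 \<le> y" "y < u" for y
    proof -
      have "y \<in> alternate_annuli" using y by (auto simp: alternate_annuli_def u_def)
      have "0 < y" using y \<open>0 < u\<close> by linarith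
      have "ln (u / 2) \<le> ln y" using y \<open>0 < u\<close> \<open>0 < y\<close> by simp
      then have "1 - ln y \<le> 2 * t"
        using lnu' ln2 t \<open>0 < u\<close> by (simp add: ln_div)
      moreover have "u \<le> 1" unfolding u_def by (rule power_le_one) auto
      then have "0 < 1 - ln y" using y \<open>0 < y\<close> ln_le_minus_one[of y] by linarith
      ultimately have "(2 * t) powr - b \<le> (1 - ln y) powr - b"
        using b by (intro powr_mono2') auto
      moreover have "(2::real) powr - 1 \<le> 2 powr - b"
        using b by (intro powr_mono) auto
      then have "t powr - b / 2 \<le> (2 * t) powr - b"
        using t mult_right_mono[of "1/2" "2 powr - b" "t powr - b"] by (simp add: powr_mult powr_minus_divide)
      ultimately show ?thesis
        using \<open>y \<in> alternate_annuli\<close> by (simp add: log_block_def)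
    qed
    \<comment> \<open>The annulus fills half of \<open>{0..<u}\<close>, which costs one factor 2 in
      the average; the dyadic difference costs another, giving the 8.\<close>
    have "t powr - b / 2 * (u - u / 2) \<le> (LINT y:{0..<u}|lebesgue. log_block b y)"
      by (rule set_lint_Ico_ge) (use \<open>0 < u\<close> ge b in \<open>auto intro: set_integrable_log_block log_block_bounds\<close>)
    then have "t powr - b / 4 \<le> average (log_block b) {0..<u}"
      using \<open>0 < u\<close> by (simp add: average_Ico field_simps)
    moreover have "dyadic_diff {0..<2 * u} (log_block b) x = average (log_block b) {0..<u} / 2"
      using \<open>0 < u\<close> \<open>x < u\<close> x alternate_annuli_gap
      by (intro dyadic_diff_left_half) (auto simp: log_block_def u_def)
    ultimately show ?thesis by (simp add: I_def u_def)
  qed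
  have "t powr (1 / 2 - b) = sqrt t * t powr - b"
    using t powr_add[of t "1 / 2" "- b"] by (simp add: powr_half_sqrt)
  then have "(t powr (1 / 2 - b) / 32)\<^sup>2 = t * (t powr - b)\<^sup>2 / 1024"
    using t by (simp only: power_divide power_mult_distrib) simp
  \<comment> \<open>This amounts to 5 * 64 = 320 being at most 1024, the square of 32.\<close>
  also have "\<dots> \<le> t / 5 * (t powr - b / 8)\<^sup>2"
    using t by (simp add: power_divide)
  also have "\<dots> \<le> real J * (t powr - b / 8)\<^sup>2"
    by (intro mult_right_mono J) auto
  also have "\<dots> = (\<Sum>j<J. (t powr - b / 8)\<^sup>2)" by simp
  also have "\<dots> \<le> (\<Sum>j<J. (dyadic_diff (I j) (log_block b) x)\<^sup>2)"
    by (intro sum_mono power_mono diff) auto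
  also have "\<dots> = (\<Sum>Q\<in>I ` {..<J}. (dyadic_diff Q (log_block b) x)\<^sup>2)"
    using inj by (subst sum.reindex) (auto intro: inj_on_subset)
  finally have le: "(t powr (1 / 2 - b) / 32)\<^sup>2
      \<le> (\<Sum>Q\<in>I ` {..<J}. (dyadic_diff Q (log_block b) x)\<^sup>2)" .
  have "I j \<in> {Q \<in> dyadic_intervals. Q \<subseteq> Q0}" for j
    using dyadic_interval_zero[of j] subset_trans[OF I1 Q0] by (simp only: I_def mem_Collect_eq)
  then have "I ` {..<J} \<subseteq> {Q \<in> dyadic_intervals. Q \<subseteq> Q0}" by blast
  then show ?thesis
    unfolding t_def[symmetric] using le by (intro square_function_ge) auto
qed

section \<open>The weight with a logarithmic singularity, and divergence against it\<close>

text \<open>Off the unit interval, \<open>inverse (1 + x\<^sup>2)\<close> keeps the weight positive,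
  integrable over the whole line and, away from 0, below \<open>1 / \<bar>x\<bar>\<close>.\<close>

definition tail_weight :: "real \<Rightarrow> real \<Rightarrow> real" where
  "tail_weight e x = (if 0 < x \<and> x < 1 then (1 - ln x) powr - (1 + e) / x else inverse (1 + x\<^sup>2))"

lemma tail_weight_measurable [measurable]: "tail_weight e \<in> borel_measurable borel"
  unfolding tail_weight_def by measurable

lemma tail_weight_pos: "0 < tail_weight e x"
proof (cases "0 < x \<and> x < 1")
  case True
  then have "ln x < 0" by simp
  then have "ln x \<noteq> 1" by linarith
  with True show ?thesis by (simp add: tail_weight_def)
next
  case False
  then show ?thesis by (auto simp: tail_weight_def add_pos_nonneg)
qed

text \<open>On the unit interval the logarithmic factor is a negative power of a number above 1;
  elsewhere \<open>2 * \<bar>x\<bar> \<le> 1 + x\<^sup>2\<close> suffices.\<close>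

lemma tail_weight_le:
  assumes "0 < e" "x \<noteq> 0"
  shows "tail_weight e x \<le> 1 / \<bar>x\<bar>"
proof (cases "0 < x \<and> x < 1")
  case True
  then have "ln x < 0" by simp
  then have "(1 - ln x) powr - (1 + e) \<le> (1 - ln x) powr 0"
    using assms by (intro powr_mono) auto
  moreover have "ln x \<noteq> 1" using \<open>ln x < 0\<close> by linarith
  ultimately show ?thesis using True by (simp add: tail_weight_def divide_right_mono)
next
  case False
  have "2 * \<bar>x\<bar> \<le> 1 + x\<^sup>2"
    using zero_le_power2[of "\<bar>x\<bar> - 1"] by (simp add: power2_eq_square algebra_simps)
  then have "\<bar>x\<bar> \<le> 1 + x\<^sup>2" by linarith
  then have "inverse (1 + x\<^sup>2) \<le> inverse \<bar>x\<bar>"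
    using assms by (intro le_imp_inverse_le) auto
  with False show ?thesis by (auto simp: tail_weight_def inverse_eq_divide)
qed

lemma integrable_tail_weight:
  assumes "0 < e"
  shows "integrable lebesgue (tail_weight e)"
proof -
  have "integrable lborel (\<lambda>x::real. inverse (1 + x\<^sup>2))"
    using integrable_inverse_1_plus_square by (simp add: set_integrable_def einterval_def)
  then have "integrable lebesgue (\<lambda>x::real. inverse (1 + x\<^sup>2))"
    by (simp add: integrable_completion)
  then have "integrable lebesgue (\<lambda>x::real. indicator (- {0<..<1}) x *\<^sub>R inverse (1 + x\<^sup>2))"
    by (intro integrable_mult_indicator) auto
  moreover have "integrable lebesgue (\<lambda>x::real. indicator {0<..<1} x *\<^sub>R ((1 - ln x) powr - (1 + e) / x))"
    using set_integrable_log_kernel[OF assms] by (simp add: set_integrable_def)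
  ultimately have "integrable lebesgue (\<lambda>x::real. indicator {0<..<1} x *\<^sub>R ((1 - ln x) powr - (1 + e) / x)
      + indicator (- {0<..<1}) x *\<^sub>R inverse (1 + x\<^sup>2))"
    by (rule Bochner_Integration.integrable_add[rotated])
  also have "(\<lambda>x::real. indicator {0<..<1} x *\<^sub>R ((1 - ln x) powr - (1 + e) / x)
      + indicator (- {0<..<1}) x *\<^sub>R inverse (1 + x\<^sup>2)) = tail_weight e"
    by (auto simp: fun_eq_iff tail_weight_def indicator_def)
  finally show ?thesis .
qed

lemma borel_measurable_lebesgue_on:
  assumes "f \<in> measurable borel N"
  shows "f \<in> measurable (lebesgue_on S) N"
proof (rule measurable_restrict_space1, rule measurable_completion)
  show "f \<in> measurable lborel N"
    using assms by (simp only: measurable_lborel2)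
qed

text \<open>Both domains of the theorem are instances of \<open>Q0\<close>. Membership fails because
  the integral is infinite already over \<open>{0<..<d}\<close>, not for want of
  measurability.\<close>

lemma square_function_log_block_notin_Lp:
  assumes p: "2 < p" and e: "e = (p - 2) / 4" and b: "b = (1 + e) / p"
    and Q0: "{0..<1} \<subseteq> Q0" "Q0 \<in> sets lebesgue"
  shows "square_function Q0 (log_block b) \<notin> Lp_enn p (weighted_measure Q0 (tail_weight e))"
proof -
  define d where "d = exp (-4 :: real)"
  have d: "0 < d" "d \<le> 1" by (auto simp: d_def)
  have b01: "0 \<le> b" "b \<le> 1" using p by (auto simp: b e field_simps)
  \<comment> \<open>The choice of \<open>e\<close> means \<open>p / 2 - 1 = 2 * e\<close>, and
    \<open>b * p = 1 + e\<close> removes one of the two copies. The exponent left cancels the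
    \<open>e\<close> in the weight.\<close>
  have be: "(1 / 2 - b) * p = e" using p by (simp add: b e field_simps)
  define K where "K = (1 / 32 :: real) powr p"
  have "0 < K" by (simp add: K_def)
  \<comment> \<open>An explicit measurable minorant of the \<open>p\<close>-th power of the square
    function, to which the density formula applies.\<close>
  define h where "h = (\<lambda>x. ennreal (indicator {0<..<d} x * (K * (1 - ln x) powr e)))"
  have hm: "h \<in> borel_measurable (lebesgue_on Q0)" "(\<lambda>x. ennreal (tail_weight e x)) \<in> borel_measurable (lebesgue_on Q0)"
    unfolding h_def by (rule borel_measurable_lebesgue_on, measurable)+
  have "h x \<le> ennpowr (square_function Q0 (log_block b) x) p" for x
  proof (cases "x \<in> {0<..<d}")
    case True
    then have x: "0 < x" "x < exp (-4)" by (auto simp: d_def)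
    then have "ln x < -4" by (metis ln_exp ln_less_cancel_iff exp_gt_zero)
    let ?r = "(1 - ln x) powr (1 / 2 - b) / 32"
    have le: "ennreal ?r \<le> square_function Q0 (log_block b) x"
      by (rule square_function_log_block_ge[OF b01 Q0(1) x])
    have "K * (1 - ln x) powr e = ?r powr p"
      by (simp add: K_def powr_divide powr_powr be)
    moreover have "?r powr p \<le> enn2real (square_function Q0 (log_block b) x) powr p"
      if "square_function Q0 (log_block b) x \<noteq> \<infinity>"
      using p enn2real_mono[OF le] that by (intro powr_mono2) (auto simp: less_top)
    ultimately show ?thesis
      using True by (auto simp: h_def ennpowr_def intro: ennreal_leI)
  qed (simp add: h_def)
  then have "(\<integral>\<^sup>+x. h x \<partial>weighted_measure Q0 (tail_weight e))
      \<le> (\<integral>\<^sup>+x. ennpowr (square_function Q0 (log_block b) x) p \<partial>weighted_measure Q0 (tail_weight e))"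
    by (intro nn_integral_mono)
  moreover have "(\<integral>\<^sup>+x. h x \<partial>weighted_measure Q0 (tail_weight e)) = \<infinity>"
  proof -
    have "(\<integral>\<^sup>+x. h x \<partial>weighted_measure Q0 (tail_weight e))
        = (\<integral>\<^sup>+x. ennreal (tail_weight e x) * h x \<partial>lebesgue_on Q0)"
      unfolding weighted_measure_def using hm by (intro nn_integral_density) auto
    also have "\<dots> = (\<integral>\<^sup>+x\<in>Q0. (ennreal (tail_weight e x) * h x) \<partial>lebesgue)"
      using Q0 by (intro nn_integral_restrict_space) auto
    also have "\<dots> = (\<integral>\<^sup>+x. ennreal K * (ennreal (1 / (x * (1 - ln x))) * indicator {0<..<d} x) \<partial>lebesgue)"
    proof (rule nn_integral_cong)
      fix x
      show "ennreal (tail_weight e x) * h x * indicator Q0 x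
        = ennreal K * (ennreal (1 / (x * (1 - ln x))) * indicator {0<..<d} x)"
      proof (cases "x \<in> {0<..<d}")
        case True
        then have x: "0 < x" "x < 1" using d by auto
        then have "ln x < 0" by simp
        have "x \<in> Q0" using x Q0 by auto
        have "ln x < 1" using \<open>ln x < 0\<close> by linarith
        have "tail_weight e x * (K * (1 - ln x) powr e)
            = K * ((1 - ln x) powr - (1 + e) * (1 - ln x) powr e) / x"
          using x by (simp add: tail_weight_def)
        also have "(1 - ln x) powr - (1 + e) * (1 - ln x) powr e = (1 - ln x) powr - 1"
          by (subst powr_add[symmetric]) simp
        also have "\<dots> = 1 / (1 - ln x)"
          using \<open>ln x < 1\<close> by (simp add: powr_minus_divide)
        finally have "tail_weight e x * (K * (1 - ln x) powr e) = K * (1 / (x * (1 - ln x)))"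
          by (simp add: mult.commute)
        then show ?thesis
          using True \<open>x \<in> Q0\<close> \<open>0 < K\<close> tail_weight_pos[of e x]
          by (simp add: h_def ennreal_mult'[symmetric] less_imp_le)
      qed (simp add: h_def)
    qed
    also have "\<dots> = ennreal K * (\<integral>\<^sup>+x\<in>{0<..<d}. ennreal (1 / (x * (1 - ln x))) \<partial>lborel)"
      by (simp add: nn_integral_completion, subst nn_integral_cmult) auto
    also have "\<dots> = \<infinity>"
      using nn_integral_log_kernel_infinite[OF d] \<open>0 < K\<close> by (simp add: ennreal_mult_top)
    finally show ?thesis .
  qed
  ultimately show ?thesis
    by (auto simp: Lp_enn_def top_unique)
qed

section \<open>Assembling the weights and the function\<close>

text \<open>Positivity is asked only off the origin because the power weight vanishes at 0, a null
  set.\<close>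

lemma weight_on_UNIV_I:
  assumes "w \<in> borel_measurable borel" "\<And>x. x \<noteq> 0 \<Longrightarrow> 0 < w x"
    and "\<And>a b. set_integrable lebesgue {a..<b} w"
  shows "weight_on UNIV w"
  unfolding weight_on_def
proof (intro conjI)
  show "w \<in> borel_measurable (lebesgue_on UNIV)"
    by (rule borel_measurable_lebesgue_on[OF assms(1)])
  have "AE x in lborel. x \<noteq> (0::real)"
    by (rule AE_lborel_singleton)
  then have "AE x in lebesgue. x \<noteq> (0::real)"
    by (rule AE_completion)
  then show "AE x in lebesgue_on UNIV. 0 < w x"
    unfolding lebesgue_on_UNIV_eq by (rule eventually_mono) (rule assms(2))
qed (use assms(3) in \<open>auto simp: intervals_def\<close>)

theorem proposition1p2:
  fixes p :: real
  assumes "2 < p"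
  shows "\<exists>(w :: real \<Rightarrow> real) (\<sigma> :: real \<Rightarrow> real) (f :: real \<Rightarrow> real).
    weight_on UNIV w \<and> weight_on UNIV \<sigma> \<and>
    Ainf_char \<sigma> < \<infinity> \<and> Ap_char p w \<sigma> < \<infinity> \<and>
    f \<in> Lp p (weighted_measure UNIV \<sigma>) \<and>
    closure {x. f x \<noteq> 0} \<subseteq> {0..1} \<and>
    square_function UNIV (\<lambda>x. f x * \<sigma> x) \<notin> Lp_enn p (weighted_measure UNIV w) \<and>
    square_function {0..<1} (\<lambda>x. f x * \<sigma> x) \<notin> Lp_enn p (weighted_measure {0..<1} w)"
proof -
  define e where "e = (p - 2) / 4"
  define b where "b = (1 + e) / p"
  define g where "g = 1 / (p - 1)"
  define \<sigma> where "\<sigma> = (\<lambda>x::real. \<bar>x\<bar> powr g)"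
  \<comment> \<open>This divides by \<open>\<sigma>\<close>: the annuli lie in the positive
    half-line, where \<open>x\<close> equals its modulus, and \<open>log_block\<close> vanishes
    elsewhere.\<close>
  define f where "f = (\<lambda>x. log_block b x * x powr - g)"
  have e: "0 < e" and g: "0 < g" using assms by (auto simp: e_def g_def)
  have f\<sigma>: "(\<lambda>x. f x * \<sigma> x) = log_block b"
  proof
    fix x
    show "f x * \<sigma> x = log_block b x"
    proof (cases "x \<in> alternate_annuli")
      case True
      then have "0 < x" using alternate_annuli_subset by auto
      then show ?thesis by (simp add: f_def \<sigma>_def powr_minus)
    qed (simp add: f_def log_block_def)
  qed
  have fm: "f \<in> borel_measurable borel" "\<sigma> \<in> borel_measurable borel"
    unfolding f_def \<sigma>_def by measurable
  have supp: "f x = 0" if "x \<notin> {0..1}" for x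
    using that alternate_annuli_subset by (auto simp: f_def log_block_def indicator_def)
  \<comment> \<open>On the annuli this is an equality: \<open>b * p = 1 + e\<close> gives the
    logarithmic factor and \<open>g - g * p = - 1\<close> gives \<open>1 / x\<close>. Elsewhere the
    left side is 0.\<close>
  have pow: "ennreal (\<sigma> x) * ennreal (\<bar>f x\<bar> powr p) \<le> ennreal (tail_weight e x)" for x
  proof (cases "x \<in> alternate_annuli")
    case True
    then have x: "0 < x" "x < 1" using alternate_annuli_subset by auto
    then have "ln x < 0" by simp
    have exps: "(- b) * p = - (1 + e)" "g + (- g) * p = - 1"
      using assms by (auto simp: b_def g_def field_simps)
    have "\<bar>f x\<bar> powr p = (1 - ln x) powr ((- b) * p) * x powr ((- g) * p)"
      using True by (simp add: f_def log_block_def abs_mult powr_mult powr_powr)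
    then have "\<sigma> x * \<bar>f x\<bar> powr p = (1 - ln x) powr ((- b) * p) * x powr (g + (- g) * p)"
      using x by (simp only: powr_add) (simp add: \<sigma>_def)
    also have "\<dots> = (1 - ln x) powr - (1 + e) * x powr - 1"
      by (simp only: exps)
    also have "\<dots> = tail_weight e x"
      using x by (simp add: tail_weight_def powr_minus_divide)
    finally show ?thesis
      by (simp add: ennreal_mult'[symmetric] \<sigma>_def)
  qed (simp add: f_def log_block_def)
  have "weight_on UNIV (tail_weight e)"
    using integrable_tail_weight[OF e] tail_weight_pos
    by (intro weight_on_UNIV_I) (auto simp: set_integrable_def simp del: real_scaleR_def
        intro: integrable_mult_indicator)
  moreover have "weight_on UNIV \<sigma>"
    using fm set_integrable_powr_abs[OF g] by (intro weight_on_UNIV_I) (auto simp: \<sigma>_def)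
  moreover have "Ainf_char \<sigma> < \<infinity>"
    unfolding \<sigma>_def by (rule Ainf_char_powr_abs_finite[OF g])
  moreover have "Ap_char p (tail_weight e) \<sigma> < \<infinity>"
    unfolding \<sigma>_def g_def
    using assms integrable_tail_weight[OF e] tail_weight_pos[THEN less_imp_le] tail_weight_le[OF e]
    by (intro Ap_char_powr_abs_finite) auto
  moreover have "f \<in> Lp p (weighted_measure UNIV \<sigma>)"
  proof -
    have m: "(\<lambda>x. ennreal (\<sigma> x)) \<in> borel_measurable lebesgue"
      "(\<lambda>x. ennreal (\<bar>f x\<bar> powr p)) \<in> borel_measurable lebesgue" "f \<in> borel_measurable lebesgue"
      using fm by (auto intro!: measurable_completion)
    have "(\<integral>\<^sup>+x. ennreal (\<bar>f x\<bar> powr p) \<partial>weighted_measure UNIV \<sigma>)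
        = (\<integral>\<^sup>+x. ennreal (\<sigma> x) * ennreal (\<bar>f x\<bar> powr p) \<partial>lebesgue)"
      unfolding weighted_measure_def lebesgue_on_UNIV_eq using m(1,2) by (rule nn_integral_density)
    also have "\<dots> \<le> (\<integral>\<^sup>+x. ennreal (tail_weight e x) \<partial>lebesgue)"
      by (intro nn_integral_mono pow)
    also have "\<dots> < \<infinity>"
      using integrable_tail_weight[OF e] tail_weight_pos[THEN less_imp_le]
      by (simp add: nn_integral_eq_integral)
    finally show ?thesis
      using m by (simp add: Lp_def weighted_measure_def lebesgue_on_UNIV_eq)
  qed
  moreover have "closure {x. f x \<noteq> 0} \<subseteq> {0..1}"
  proof (rule closure_minimal)
    show "{x. f x \<noteq> 0} \<subseteq> {0..1}" using supp by blast
  qed simp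
  moreover have "square_function UNIV (\<lambda>x. f x * \<sigma> x) \<notin> Lp_enn p (weighted_measure UNIV (tail_weight e))"
    unfolding f\<sigma> by (rule square_function_log_block_notin_Lp[OF assms e_def b_def]) auto
  moreover have "square_function {0..<1} (\<lambda>x. f x * \<sigma> x) \<notin> Lp_enn p (weighted_measure {0..<1} (tail_weight e))"
    unfolding f\<sigma> by (rule square_function_log_block_notin_Lp[OF assms e_def b_def]) auto
  ultimately show ?thesis by blast
qed

end
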